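(* Let $\mathcal{M}=\langle S,R,V\rangle$ be a Kripke model and let $ue(\mathcal{M})$ be its ($\exists\forall$-version) ultrafilter extension for contingency logic. For all formulas $\phi\in\mathcal{L}(\nabla)$ and all ultrafilters $s$ over $S$, we have $V(\phi)\in s$ iff $ue(\mathcal{M}),s\vDash\phi$. As a corollary, for all $w\in S$, we have $(\mathcal{M},w)\equiv_{\mathcal{L}(\nabla)}(ue(\mathcal{M}),\pi_w)$.
   Context: A Kripke model is $\mathcal{M}=\langle S,R,V\rangle$ with $S\neq\emptyset$, $R\subseteq S\times S$, $V:\mathbf{P}\to\mathcal{P}(S)$, where $\mathbf{P}$ is the set of propositional variables. $\mathcal{L}(\nabla)$ is the propositional language with $\neg,\wedge$ and a unary operator $\nabla$ (contingency); $\Delta\phi$ abbreviates $\neg\nabla\phi$. Semantics: $\mathcal{M},s\vDash\nabla\phi$ iff there are $t,u\in S$ with $Rst$, $Rsu$, $\mathcal{M},t\vDash\phi$ and $\mathcal{M},u\nvDash\phi$; Booleans as usual. $V(\phi)=\{x\in S\mid\mathcal{M},x\vDash\phi\}$. $\equiv_{\mathcal{L}(\nabla)}$ between pointed models means satisfying the same $\mathcal{L}(\nabla)$-formulas. For $X\subseteq S$, $\overline{X}=S\setminus X$ and $m_\nabla(X)=\{s\in S\mid Rst,Rsu\text{ for some }t\in X\text{ and some }u\notin X\}$, $m_\Delta(X)=\{s\in S\mid\text{for all }t,u,\text{ if }Rst\text{ and }Rsu,\text{ then }(t\in X\text{ iff }u\in X)\}$. Ultrafilter extension ($\exists\forall$-version):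 $ue(\mathcal{M})=\langle Uf(S),R^{ue},V^{ue}\rangle$, where $Uf(S)$ is the set of all ultrafilters over $S$; $R^{ue}st$ iff there exists $X\subseteq S$ such that $m_\nabla(X)\in s$ and, for all $Y\subseteq S$, if $m_\Delta(Y)\cap m_\Delta(\overline{X}\cup Y)\in s$, then $Y\in t$; and $V^{ue}(p)=\{s\in Uf(S)\mid V(p)\in s\}$. For $w\in S$, $\pi_w=\{X\subseteq S\mid w\in X\}$. *)

theory Defs
  imports Main
begin

record ('w, 'p) kripke =
  worlds :: "'w set"
  acc :: "('w \<times> 'w) set"
  val :: "'p \<Rightarrow> 'w set"

definition kripke_model :: "('w, 'p) kripke \<Rightarrow> bool" where
  "kripke_model M \<longleftrightarrow>
     worlds M \<noteq> {} \<and> acc M \<subseteq> worlds M \<times> worlds M \<and> (\<forall>p. val M p \<subseteq> worlds M)"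

datatype 'p form =
    Var 'p
  | Neg "'p form"
  | Conj "'p form" "'p form"
  | Nabla "'p form"

primrec sat :: "('w, 'p) kripke \<Rightarrow> 'w \<Rightarrow> 'p form \<Rightarrow> bool" where
  "sat M s (Var p) \<longleftrightarrow> s \<in> val M p"
| "sat M s (Neg \<phi>) \<longleftrightarrow> \<not> sat M s \<phi>"
| "sat M s (Conj \<phi> \<psi>) \<longleftrightarrow> sat M s \<phi> \<and> sat M s \<psi>"
| "sat M s (Nabla \<phi>) \<longleftrightarrow>
     (\<exists>t\<in>worlds M. \<exists>u\<in>worlds M.
        (s, t) \<in> acc M \<and> (s, u) \<in> acc M \<and> sat M t \<phi> \<and> \<not> sat M u \<phi>)"

definition truth_set :: "('w, 'p) kripke \<Rightarrow> 'p form \<Rightarrow> 'w set" where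
  "truth_set M \<phi> = {x \<in> worlds M. sat M x \<phi>}"

definition nabla_equiv ::
  "('v, 'p) kripke \<Rightarrow> 'v \<Rightarrow> ('w, 'p) kripke \<Rightarrow> 'w \<Rightarrow> bool" where
  "nabla_equiv M s N t \<longleftrightarrow> (\<forall>\<phi>. sat M s \<phi> \<longleftrightarrow> sat N t \<phi>)"

definition m_nabla :: "('w, 'p) kripke \<Rightarrow> 'w set \<Rightarrow> 'w set" where
  "m_nabla M X =
     {s \<in> worlds M. \<exists>t u. (s, t) \<in> acc M \<and> (s, u) \<in> acc M \<and> t \<in> X \<and> u \<notin> X}"

definition m_delta :: "('w, 'p) kripke \<Rightarrow> 'w set \<Rightarrow> 'w set" where
  "m_delta M X =
     {s \<in> worlds M. \<forall>t u. (s, t) \<in> acc M \<and> (s, u) \<in> acc M \<longrightarrow> (t \<in> X \<longleftrightarrow> u \<in> X)}"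

text \<open>Ultrafilters are taken over a carrier set rather than over a whole type, so they are
  families of subsets of the carrier.\<close>

definition ultrafilter_on :: "'w set \<Rightarrow> 'w set set \<Rightarrow> bool" where
  "ultrafilter_on S F \<longleftrightarrow>
     F \<subseteq> Pow S \<and> S \<in> F \<and> {} \<notin> F \<and>
     (\<forall>X\<in>F. \<forall>Y\<in>F. X \<inter> Y \<in> F) \<and>
     (\<forall>X\<in>F. \<forall>Y. X \<subseteq> Y \<and> Y \<subseteq> S \<longrightarrow> Y \<in> F) \<and>
     (\<forall>X. X \<subseteq> S \<longrightarrow> X \<in> F \<or> S - X \<in> F)"

definition Uf :: "'w set \<Rightarrow> 'w set set set" where
  "Uf S = {F. ultrafilter_on S F}"

definition principal_uf :: "'w set \<Rightarrow> 'w \<Rightarrow> 'w set set" where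
  "principal_uf S w = {X. X \<subseteq> S \<and> w \<in> X}"

definition ue_acc :: "('w, 'p) kripke \<Rightarrow> ('w set set \<times> 'w set set) set" where
  "ue_acc M =
     {(s, t). s \<in> Uf (worlds M) \<and> t \<in> Uf (worlds M) \<and>
        (\<exists>X. X \<subseteq> worlds M \<and> m_nabla M X \<in> s \<and>
           (\<forall>Y. Y \<subseteq> worlds M \<longrightarrow>
              m_delta M Y \<inter> m_delta M ((worlds M - X) \<union> Y) \<in> s \<longrightarrow> Y \<in> t))}"

definition ue :: "('w, 'p) kripke \<Rightarrow> ('w set set, 'p) kripke" where
  "ue M =
     \<lparr>worlds = Uf (worlds M),
      acc = ue_acc M,
      val = (\<lambda>p. {s \<in> Uf (worlds M). val M p \<in> s})\<rparr>"

lemma principal_uf_in_Uf: "w \<in> S \<Longrightarrow> principal_uf S w \<in> Uf S"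
  unfolding principal_uf_def Uf_def ultrafilter_on_def by simp blast

lemma kripke_model_ue:
  assumes "kripke_model M"
  shows "kripke_model (ue M)"
proof -
  obtain w where "w \<in> worlds M"
    using assms by (auto simp: kripke_model_def)
  then have "Uf (worlds M) \<noteq> {}"
    using principal_uf_in_Uf[of w "worlds M"] by auto
  moreover have "ue_acc M \<subseteq> Uf (worlds M) \<times> Uf (worlds M)"
    unfolding ue_acc_def by blast
  ultimately show ?thesis
    by (simp add: kripke_model_def ue_def Collect_restrict)
qed

end

theory Submission
  imports Defs
begin

text \<open>The accessibility relation of \<^term>\<open>ue M\<close> looks unlike the classical one, in which
  \<open>t\<close> is a successor of \<open>s\<close> when \<open>t\<close> contains every \<open>Y\<close> whose box lies in \<open>s\<close>. The
  contingency language cannot express the box outright, but it can do so near a contingent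
  proposition: at a world that sees both \<open>X\<close> and its complement, the conjunction
  \<open>\<Delta> Y \<and> \<Delta> (X \<rightarrow> Y)\<close> says that all successors lie in \<open>Y\<close>. If instead they all avoided
  \<open>Y\<close>, then \<open>X \<rightarrow> Y\<close> would reduce to the complement of \<open>X\<close> on them and so would be
  contingent (\<open>m_nabla_imp_box\<close>). Since a witness \<open>X\<close> of accessibility from \<open>s\<close> has
  \<^term>\<open>m_nabla M X \<in> s\<close>, accessibility from \<open>s\<close> is the classical relation as soon as some
  such \<open>X\<close> exists, and \<open>s\<close> has no successor otherwise (\<open>ue_acc_iff_box\<close>).

  What remains is the classical argument. The sets whose box lies in \<open>s\<close> form a filter. If
  \<^term>\<open>m_nabla M A \<in> s\<close>, every member of this filter meets both \<open>A\<close> and its complement, so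
  the ultrafilter lemma gives a successor on each side (\<open>ex_successor_containing\<close>). If
  \<^term>\<open>m_nabla M A \<notin> s\<close>, then the box of \<open>A\<close> or that of its complement is in \<open>s\<close>, and all
  successors of \<open>s\<close> agree about \<open>A\<close> (\<open>successors_agree\<close>). Hence the claim about \<open>\<nabla>\<close>; the
  other connectives are the closure properties of ultrafilters.\<close>

section \<open>Filters on a carrier and the ultrafilter lemma\<close>

text \<open>The improper filter is included, because the sets whose box lies in an ultrafilter may
  include the empty set (at dead ends).\<close>

definition filter_on :: "'a set \<Rightarrow> 'a set set \<Rightarrow> bool" where
  "filter_on S F \<longleftrightarrow>
     F \<subseteq> Pow S \<and> S \<in> F \<and>
     (\<forall>X\<in>F. \<forall>Y\<in>F. X \<inter> Y \<in> F) \<and>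
     (\<forall>X\<in>F. \<forall>Y. X \<subseteq> Y \<and> Y \<subseteq> S \<longrightarrow> Y \<in> F)"

definition adjoin :: "'a set \<Rightarrow> 'a set set \<Rightarrow> 'a set \<Rightarrow> 'a set set" where
  "adjoin S F A = {Z. Z \<subseteq> S \<and> (\<exists>Y\<in>F. Y \<inter> A \<subseteq> Z)}"

lemma filter_on_adjoin:
  assumes "filter_on S F"
  shows "filter_on S (adjoin S F A)"
proof -
  have "Z \<inter> Z' \<in> adjoin S F A" if Z: "Z \<in> adjoin S F A" and Z': "Z' \<in> adjoin S F A" for Z Z'
  proof -
    obtain Y Y' where "Y \<in> F" "Y \<inter> A \<subseteq> Z" "Y' \<in> F" "Y' \<inter> A \<subseteq> Z'"
      using Z Z' by (auto simp: adjoin_def)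
    moreover from this have "Y \<inter> Y' \<in> F"
      using assms by (simp add: filter_on_def)
    moreover have "Y \<inter> Y' \<inter> A \<subseteq> Z \<inter> Z'"
      using calculation by blast
    ultimately show ?thesis
      using Z Z' by (auto simp: adjoin_def)
  qed
  moreover have "S \<in> adjoin S F A"
    using assms by (auto simp: adjoin_def filter_on_def)
  moreover have "Z' \<in> adjoin S F A" if "Z \<in> adjoin S F A" "Z \<subseteq> Z'" "Z' \<subseteq> S" for Z Z'
    using that unfolding adjoin_def by blast
  ultimately show ?thesis
    unfolding filter_on_def by (auto simp: adjoin_def)
qed

lemma subset_adjoin: "filter_on S F \<Longrightarrow> F \<subseteq> adjoin S F A"
  by (auto simp: adjoin_def filter_on_def)

lemma adjoined_in_adjoin: "filter_on S F \<Longrightarrow> A \<subseteq> S \<Longrightarrow> A \<in> adjoin S F A"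
  by (auto simp: adjoin_def filter_on_def)

lemma empty_in_adjoin_iff: "{} \<in> adjoin S F A \<longleftrightarrow> (\<exists>Y\<in>F. Y \<inter> A = {})"
  by (auto simp: adjoin_def)

text \<open>A maximal proper filter must decide every \<open>A\<close>: either adjoining \<open>A\<close> keeps it proper, so
  that \<open>A\<close> is already a member, or some member misses \<open>A\<close>, so that the complement is one.\<close>

lemma ultrafilter_on_maximal:
  assumes F: "filter_on S F" "{} \<notin> F"
    and max: "\<And>G. filter_on S G \<Longrightarrow> {} \<notin> G \<Longrightarrow> F \<subseteq> G \<Longrightarrow> G = F"
  shows "ultrafilter_on S F"
proof -
  have "A \<in> F \<or> S - A \<in> F" if A: "A \<subseteq> S" for A
  proof (cases "{} \<in> adjoin S F A")
    case True
    then obtain Y where "Y \<in> F" "Y \<inter> A = {}"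
      by (auto simp: empty_in_adjoin_iff)
    moreover from this have "Y \<subseteq> S - A"
      using F by (auto simp: filter_on_def)
    ultimately show ?thesis
      using F by (auto simp: filter_on_def)
  next
    case False
    then have "adjoin S F A = F"
      using max filter_on_adjoin subset_adjoin F(1) by blast
    then show ?thesis
      using adjoined_in_adjoin[OF F(1) A] by simp
  qed
  then show ?thesis
    using F by (simp add: filter_on_def ultrafilter_on_def)
qed

lemma filter_on_Union_chain:
  assumes "C \<noteq> {}" and filters: "\<And>F. F \<in> C \<Longrightarrow> filter_on S F"
    and chain: "\<And>F G. F \<in> C \<Longrightarrow> G \<in> C \<Longrightarrow> F \<subseteq> G \<or> G \<subseteq> F"
  shows "filter_on S (\<Union>C)"
  unfolding filter_on_def
proof (intro conjI ballI allI impI)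
  show "\<Union>C \<subseteq> Pow S"
    using filters by (intro Union_least) (simp add: filter_on_def)
  show "S \<in> \<Union>C"
    using assms(1) filters by (auto simp: filter_on_def)
next
  fix X Y assume "X \<in> \<Union>C" "Y \<in> \<Union>C"
  then obtain F G where mem: "X \<in> F" "F \<in> C" "Y \<in> G" "G \<in> C"
    by blast
  \<comment> \<open>Comparability puts both sets into the larger of the two filters.\<close>
  obtain H where "H \<in> C" "X \<in> H" "Y \<in> H"
    using mem chain[of F G] by blast
  then have "X \<inter> Y \<in> H"
    using filters[of H] by (simp add: filter_on_def)
  with \<open>H \<in> C\<close> show "X \<inter> Y \<in> \<Union>C"
    by (rule UnionI)
next
  fix X Y assume "X \<in> \<Union>C" "X \<subseteq> Y \<and> Y \<subseteq> S"
  then obtain F where "X \<in> F" "F \<in> C" "X \<subseteq> Y" "Y \<subseteq> S"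
    by blast
  then have "Y \<in> F"
    using filters[of F] unfolding filter_on_def by blast
  with \<open>F \<in> C\<close> show "Y \<in> \<Union>C"
    by (rule UnionI)
qed

lemma ex_ultrafilter_on_extending:
  assumes "filter_on S F" "{} \<notin> F"
  obtains U where "ultrafilter_on S U" "F \<subseteq> U"
proof -
  define P where "P = {G. filter_on S G \<and> {} \<notin> G \<and> F \<subseteq> G}"
  have "\<exists>U\<in>P. \<forall>G\<in>P. U \<subseteq> G \<longrightarrow> G = U"
  proof (rule subset_Zorn_nonempty)
    show "P \<noteq> {}"
      using assms by (auto simp: P_def)
    fix C assume "C \<noteq> {}" and C: "subset.chain P C"
    then have "filter_on S (\<Union>C)"
      by (intro filter_on_Union_chain) (auto simp: subset.chain_def P_def)
    then show "\<Union>C \<in> P"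
      using \<open>C \<noteq> {}\<close> C by (auto simp: subset.chain_def P_def)
  qed
  then obtain U where "U \<in> P" and max: "\<And>G. G \<in> P \<Longrightarrow> U \<subseteq> G \<Longrightarrow> G = U"
    by blast
  have "ultrafilter_on S U"
  proof (rule ultrafilter_on_maximal)
    show "filter_on S U" "{} \<notin> U"
      using \<open>U \<in> P\<close> by (simp_all add: P_def)
    show "G = U" if "filter_on S G" "{} \<notin> G" "U \<subseteq> G" for G
      using that max[of G] \<open>U \<in> P\<close> by (auto simp: P_def)
  qed
  moreover have "F \<subseteq> U"
    using \<open>U \<in> P\<close> by (simp add: P_def)
  ultimately show thesis
    by (rule that)
qed

lemma filter_on_ultrafilter: "ultrafilter_on S F \<Longrightarrow> filter_on S F"
  by (simp add: filter_on_def ultrafilter_on_def)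

lemma ultrafilter_mono:
  "ultrafilter_on S F \<Longrightarrow> X \<in> F \<Longrightarrow> X \<subseteq> Y \<Longrightarrow> Y \<subseteq> S \<Longrightarrow> Y \<in> F"
  by (auto simp: ultrafilter_on_def)

lemma ultrafilter_Int_iff:
  assumes "ultrafilter_on S F" "X \<subseteq> S" "Y \<subseteq> S"
  shows "X \<inter> Y \<in> F \<longleftrightarrow> X \<in> F \<and> Y \<in> F"
  using ultrafilter_mono[OF assms(1), of "X \<inter> Y"] assms by (auto simp: ultrafilter_on_def)

lemma ultrafilter_Diff_iff:
  assumes "ultrafilter_on S F" "X \<subseteq> S"
  shows "S - X \<in> F \<longleftrightarrow> X \<notin> F"
proof -
  have "X \<inter> (S - X) = {}" by auto
  then show ?thesis
    using assms unfolding ultrafilter_on_def by metis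
qed

text \<open>This transfers to an ultrafilter an identity that holds only at the worlds of one of its
  members, such as those where a given proposition is contingent.\<close>

lemma ultrafilter_cong_on:
  assumes U: "ultrafilter_on S F" and "N \<in> F" "X \<subseteq> S" "Y \<subseteq> S" and eq: "N \<inter> X = N \<inter> Y"
  shows "X \<in> F \<longleftrightarrow> Y \<in> F"
proof -
  have "N \<subseteq> S"
    using U \<open>N \<in> F\<close> by (auto simp: ultrafilter_on_def)
  then show ?thesis
    using assms ultrafilter_Int_iff[OF U] by metis
qed

section \<open>Recovering the box from contingency\<close>

definition box :: "('w, 'p) kripke \<Rightarrow> 'w set \<Rightarrow> 'w set" where
  "box M Y = {x \<in> worlds M. \<forall>y. (x, y) \<in> acc M \<longrightarrow> y \<in> Y}"

lemma m_subsets [simp]: "m_nabla M X \<subseteq> worlds M" "m_delta M X \<subseteq> worlds M" "box M X \<subseteq> worlds M"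
  by (auto simp: m_nabla_def m_delta_def box_def)

text \<open>Were all successors of a world outside \<open>Y\<close>, they would belong to the second argument of
  \<^const>\<open>m_delta\<close> exactly when they are outside \<open>X\<close>, which varies where \<open>X\<close> is contingent.\<close>

lemma m_nabla_imp_box:
  assumes "kripke_model M"
  shows "m_nabla M X \<inter> (m_delta M Y \<inter> m_delta M ((worlds M - X) \<union> Y)) =
         m_nabla M X \<inter> box M Y"
proof -
  have "acc M \<subseteq> worlds M \<times> worlds M"
    using assms by (simp add: kripke_model_def)
  then show ?thesis
    unfolding m_nabla_def m_delta_def box_def by blast
qed

lemma ue_acc_iff_box:
  assumes "kripke_model M" and s: "ultrafilter_on (worlds M) s"
  shows "(s, t) \<in> ue_acc M \<longleftrightarrow>
         t \<in> Uf (worlds M) \<and> (\<exists>X\<subseteq>worlds M. m_nabla M X \<in> s) \<and>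
         (\<forall>Y\<subseteq>worlds M. box M Y \<in> s \<longrightarrow> Y \<in> t)"
proof -
  have *: "m_delta M Y \<inter> m_delta M ((worlds M - X) \<union> Y) \<in> s \<longleftrightarrow> box M Y \<in> s"
    if "m_nabla M X \<in> s" for X Y
    by (rule ultrafilter_cong_on[OF s that _ _ m_nabla_imp_box[OF assms(1)]])
      (simp_all add: le_infI1)
  have "(s, t) \<in> ue_acc M \<longleftrightarrow> t \<in> Uf (worlds M) \<and>
      (\<exists>X\<subseteq>worlds M. m_nabla M X \<in> s \<and> (\<forall>Y\<subseteq>worlds M. box M Y \<in> s \<longrightarrow> Y \<in> t))"
    using s by (simp add: ue_acc_def Uf_def * cong: conj_cong)
  then show ?thesis
    by blast
qed

lemma filter_on_box:
  assumes "kripke_model M" and s: "ultrafilter_on (worlds M) s"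
  shows "filter_on (worlds M) {Y. Y \<subseteq> worlds M \<and> box M Y \<in> s}"
proof -
  have "box M (worlds M) = worlds M"
    using assms(1) by (auto simp: box_def kripke_model_def)
  moreover have "box M (X \<inter> Y) = box M X \<inter> box M Y" for X Y
    by (auto simp: box_def)
  moreover have "box M X \<subseteq> box M Y" if "X \<subseteq> Y" for X Y
    using that by (auto simp: box_def)
  then have "box M Y \<in> s" if "X \<subseteq> Y" "box M X \<in> s" for X Y
    using that ultrafilter_mono[OF s] m_subsets(3) by meson
  ultimately show ?thesis
    using s by (auto simp: filter_on_def ultrafilter_on_def)
qed

text \<open>If the box of \<open>Y\<close> is in \<open>s\<close>, then some world lies both in that box and in
  \<^term>\<open>m_nabla M A\<close>, and its successors in \<open>A\<close> lie in \<open>Y\<close> as well. So adjoining \<open>A\<close> to the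
  filter of all such \<open>Y\<close> gives a proper filter, and any ultrafilter above it is a successor.\<close>

lemma ex_successor_containing:
  assumes M: "kripke_model M" and s: "ultrafilter_on (worlds M) s"
    and A: "A \<subseteq> worlds M" "m_nabla M A \<in> s"
  obtains t where "(s, t) \<in> ue_acc M" "A \<in> t"
proof -
  define G where "G = {Y. Y \<subseteq> worlds M \<and> box M Y \<in> s}"
  have G: "filter_on (worlds M) G"
    using filter_on_box[OF M s] by (simp add: G_def)
  have "Y \<inter> A \<noteq> {}" if "Y \<in> G" for Y
  proof -
    have "m_nabla M A \<inter> box M Y \<in> s"
      using that A(2) s by (auto simp: G_def ultrafilter_on_def)
    then have "m_nabla M A \<inter> box M Y \<noteq> {}"
      using s by (auto simp: ultrafilter_on_def)
    then show ?thesis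
      by (auto simp: m_nabla_def box_def)
  qed
  then have "{} \<notin> adjoin (worlds M) G A"
    by (auto simp: empty_in_adjoin_iff)
  then obtain t where t: "ultrafilter_on (worlds M) t" "adjoin (worlds M) G A \<subseteq> t"
    using ex_ultrafilter_on_extending filter_on_adjoin[OF G] by blast
  then have "G \<subseteq> t" "A \<in> t"
    using subset_adjoin[OF G] adjoined_in_adjoin[OF G A(1)] by blast+
  moreover have "(s, t) \<in> ue_acc M"
    unfolding ue_acc_iff_box[OF M s] using A t(1) \<open>G \<subseteq> t\<close> by (auto simp: G_def Uf_def)
  ultimately show thesis
    using that by blast
qed

lemma m_nabla_complement:
  assumes "kripke_model M"
  shows "m_nabla M (worlds M - A) = m_nabla M A"
  using assms unfolding m_nabla_def kripke_model_def by blast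

text \<open>A world that satisfies neither the box of \<open>A\<close> nor that of its complement sees both \<open>A\<close>
  and its complement. So if \<open>s\<close> rejects the contingency of \<open>A\<close>, it contains one of the two
  boxes, and that box decides \<open>A\<close> in the same way in all successors.\<close>

lemma successors_agree:
  assumes M: "kripke_model M" and s: "ultrafilter_on (worlds M) s"
    and A: "A \<subseteq> worlds M" "m_nabla M A \<notin> s"
    and t: "(s, t) \<in> ue_acc M" and u: "(s, u) \<in> ue_acc M"
  shows "A \<in> t \<longleftrightarrow> A \<in> u"
proof -
  have tu: "ultrafilter_on (worlds M) t" "ultrafilter_on (worlds M) u"
    using t u ue_acc_iff_box[OF M s] by (auto simp: Uf_def)
  have boxD: "Y \<in> t \<and> Y \<in> u" if "Y \<subseteq> worlds M" "box M Y \<in> s" for Y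
    using that t u ue_acc_iff_box[OF M s] by blast
  have "worlds M - box M A \<notin> s" if "worlds M - box M (worlds M - A) \<in> s"
  proof
    assume "worlds M - box M A \<in> s"
    then have "(worlds M - box M A) \<inter> (worlds M - box M (worlds M - A)) \<in> s"
      using that s by (auto simp: ultrafilter_on_def)
    moreover have "(worlds M - box M A) \<inter> (worlds M - box M (worlds M - A)) \<subseteq> m_nabla M A"
      using M unfolding m_nabla_def box_def kripke_model_def by blast
    ultimately show False
      using A ultrafilter_mono[OF s _ _ m_subsets(1)] by blast
  qed
  then have "box M A \<in> s \<or> box M (worlds M - A) \<in> s"
    by (auto simp: ultrafilter_Diff_iff[OF s])
  then show ?thesis
    using boxD A(1) ultrafilter_Diff_iff[OF tu(1) A(1)] ultrafilter_Diff_iff[OF tu(2) A(1)]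
    by blast
qed

lemma m_nabla_in_ultrafilter_iff:
  assumes M: "kripke_model M" and s: "ultrafilter_on (worlds M) s" and A: "A \<subseteq> worlds M"
  shows "m_nabla M A \<in> s \<longleftrightarrow>
         (\<exists>t u. (s, t) \<in> ue_acc M \<and> (s, u) \<in> ue_acc M \<and> A \<in> t \<and> A \<notin> u)"
proof
  assume *: "m_nabla M A \<in> s"
  obtain t where "(s, t) \<in> ue_acc M" "A \<in> t"
    using ex_successor_containing[OF M s A *] .
  moreover obtain u where u: "(s, u) \<in> ue_acc M" "worlds M - A \<in> u"
    using ex_successor_containing[OF M s, of "worlds M - A"] * m_nabla_complement[OF M, of A]
    by auto
  moreover have "A \<notin> u"
    using u ue_acc_iff_box[OF M s] ultrafilter_Diff_iff[OF _ A] by (auto simp: Uf_def)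
  ultimately show "\<exists>t u. (s, t) \<in> ue_acc M \<and> (s, u) \<in> ue_acc M \<and> A \<in> t \<and> A \<notin> u"
    by blast
next
  assume "\<exists>t u. (s, t) \<in> ue_acc M \<and> (s, u) \<in> ue_acc M \<and> A \<in> t \<and> A \<notin> u"
  then show "m_nabla M A \<in> s"
    using successors_agree[OF M s A] by blast
qed

section \<open>Truth in the ultrafilter extension\<close>

lemma truth_set_subset [simp]: "truth_set M \<phi> \<subseteq> worlds M"
  by (auto simp: truth_set_def)

lemma truth_set_simps:
  assumes "kripke_model M"
  shows "truth_set M (Var p) = val M p"
    and "truth_set M (Neg \<phi>) = worlds M - truth_set M \<phi>"
    and "truth_set M (Conj \<phi> \<psi>) = truth_set M \<phi> \<inter> truth_set M \<psi>"
    and "truth_set M (Nabla \<phi>) = m_nabla M (truth_set M \<phi>)"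
proof -
  show "truth_set M (Nabla \<phi>) = m_nabla M (truth_set M \<phi>)"
    using assms unfolding truth_set_def m_nabla_def kripke_model_def sat.simps by blast
qed (use assms in \<open>auto simp: truth_set_def kripke_model_def\<close>)

lemma truth_in_ue:
  assumes M: "kripke_model M" and "s \<in> Uf (worlds M)"
  shows "truth_set M \<phi> \<in> s \<longleftrightarrow> sat (ue M) s \<phi>"
  using assms(2)
proof (induction \<phi> arbitrary: s)
  case (Var p)
  then show ?case
    by (simp add: truth_set_simps[OF M] ue_def)
next
  case (Neg \<phi>)
  then show ?case
    by (simp add: truth_set_simps[OF M] Uf_def ultrafilter_Diff_iff)
next
  case (Conj \<phi> \<psi>)
  then show ?case
    by (simp add: truth_set_simps[OF M] Uf_def ultrafilter_Int_iff)
next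
  case (Nabla \<phi>)
  have acc_Uf: "t \<in> Uf (worlds M)" if "(s, t) \<in> ue_acc M" for t
    using that by (simp add: ue_acc_def)
  have "truth_set M (Nabla \<phi>) \<in> s \<longleftrightarrow>
      (\<exists>t u. (s, t) \<in> ue_acc M \<and> (s, u) \<in> ue_acc M \<and>
         truth_set M \<phi> \<in> t \<and> truth_set M \<phi> \<notin> u)"
    using Nabla.prems by (simp add: truth_set_simps[OF M] Uf_def m_nabla_in_ultrafilter_iff[OF M])
  also have "\<dots> \<longleftrightarrow> (\<exists>t\<in>Uf (worlds M). \<exists>u\<in>Uf (worlds M).
      (s, t) \<in> ue_acc M \<and> (s, u) \<in> ue_acc M \<and> sat (ue M) t \<phi> \<and> \<not> sat (ue M) u \<phi>)"
    using acc_Uf Nabla.IH by blast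
  also have "\<dots> \<longleftrightarrow> sat (ue M) s (Nabla \<phi>)"
    by (simp add: ue_def)
  finally show ?case .
qed

theorem proposition17:
  fixes M :: "('w, 'p) kripke"
  assumes "kripke_model M"
  shows "(\<forall>\<phi>. \<forall>s\<in>Uf (worlds M). truth_set M \<phi> \<in> s \<longleftrightarrow> sat (ue M) s \<phi>) \<and>
         (\<forall>w\<in>worlds M. nabla_equiv M w (ue M) (principal_uf (worlds M) w))"
proof (intro conjI ballI allI)
  fix \<phi> s assume "s \<in> Uf (worlds M)"
  then show "truth_set M \<phi> \<in> s \<longleftrightarrow> sat (ue M) s \<phi>"
    by (rule truth_in_ue[OF assms])
next
  fix w assume w: "w \<in> worlds M"
  have "sat M w \<phi> \<longleftrightarrow> truth_set M \<phi> \<in> principal_uf (worlds M) w" for \<phi>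
    using w by (auto simp: truth_set_def principal_uf_def)
  then show "nabla_equiv M w (ue M) (principal_uf (worlds M) w)"
    using truth_in_ue[OF assms principal_uf_in_Uf[OF w]] by (simp add: nabla_equiv_def)
qed

end
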